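(* Let $k\ge1$ and $d>0$, and write $\partial=\mathrm{Sq}^1$. The map $p_d=h\partial:\mathcal P_k^d\to\mathcal P_k^d$ is a projection with $$\operatorname{im}p_d=T_d(k),\qquad \ker p_d=\operatorname{im}(\partial:\mathcal P_k^{d-1}\to\mathcal P_k^d),\qquad \dim T_d(k)=\rho_k(d).$$ If $|e|=d$ and $i=i(e)$, then $$p_d(x^e)=\begin{cases}x^e,& e_i\text{ odd},\\ \displaystyle\sum_{j>i,\ e_j\text{ odd}}x^{e-\varepsilon_i+\varepsilon_j},& e_i\text{ even}.\end{cases}$$ Let $\overline M(k,d)$ be the matrix with row basis $\mathcal T_d(k)$ and labelled columns $p_d\mathrm{Sq}^{2^t}(g)$ for $t\ge1$, $2^t\le d$, and $g$ a monomial with $\deg g=d-2^t$. Then $$p_d\mathrm{Sq}^{2^t}(g)=h\,\mathrm{Sq}^{2^t+1}(g)$$ for all such $t,g$, and $$\operatorname{rank}M(k,d)=\rho_k(d-1)+\operatorname{rank}\overline M(k,d).$$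
   Context: $\mathbb N$ includes $0$. $\mathcal P_k=\mathbb F_2[x_1,\dots,x_k]$ with $\deg x_i=1$; $\mathcal P_k^n$ is the degree-$n$ part (zero for $n<0$). For $e\in\mathbb N^k$, $x^e=\prod x_i^{e_i}$, $|e|=\sum e_i$; $\varepsilon_i$ is the $i$th standard vector. Steenrod squares act linearly by $\mathrm{Sq}^r(x^a)=\sum_{b\in\mathbb N^k,|b|=r}\prod_i\binom{a_i}{b_i}x^{a+b}$ (mod 2). $\rho_k(n)=\operatorname{rank}(\mathrm{Sq}^1:\mathcal P_k^n\to\mathcal P_k^{n+1})$. For $e\neq0$ put $i(e)=\min\{i:e_i>0\}$. The linear map $h$ on $\mathcal P_k$ is given by $h(x^e)=x^{e-\varepsilon_{i(e)}}$ if $e_{i(e)}$ is even, $h(x^e)=0$ if $e_{i(e)}$ is odd, and $h(1)=0$. For $d>0$, $\mathcal T_d(k)$ is the set of degree-$d$ monomials $x^e$ with $e_{i(e)}$ odd, and $T_d(k)$ is its $\mathbb F_2$-linear span. The hit matrix $M(k,d)$ is the matrix, in monomial bases, of $\bigoplus_{t\ge0,\,2^t\le d}\mathcal P_k^{d-2^t}\to\mathcal P_k^d$, $(g_t)_t\mapsto\sum_t\mathrm{Sq}^{2^t}(g_t)$; rows are degree-$d$ monomials and columns are labelled by pairs $(t,g)$ with $g$ a monomial of degree $d-2^t$. *)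

theory Defs
  imports
    Complex_Main
    "HOL-Library.Poly_Mapping"
    "HOL-Library.Z2"
    "HOL-Library.Function_Algebras"
begin

text \<open>
  An exponent vector is a finitely supported function on the indices \<open>1, 2, \<dots>\<close>; polynomials over
  the two-element field \<^typ>\<open>bit\<close> are finitely supported functions on exponent vectors.  The number
  \<open>k\<close> of variables enters through the requirement that exponents are supported in \<open>{1..k}\<close>.
\<close>

type_synonym expo = "nat \<Rightarrow>\<^sub>0 nat"
type_synonym mpoly2 = "expo \<Rightarrow>\<^sub>0 bit"

abbreviation expo_at :: "expo \<Rightarrow> nat \<Rightarrow> nat" where
  "expo_at \<equiv> Poly_Mapping.lookup"

definition unit_expo :: "nat \<Rightarrow> expo" where
  "unit_expo i = Poly_Mapping.single i 1"

definition expos :: "nat \<Rightarrow> nat \<Rightarrow> expo set" where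
  "expos k n = {e. Poly_Mapping.keys e \<subseteq> {1..k} \<and> (\<Sum>i=1..k. expo_at e i) = n}"

definition xpow :: "expo \<Rightarrow> mpoly2" where
  "xpow e = Poly_Mapping.single e 1"

definition homog :: "nat \<Rightarrow> nat \<Rightarrow> mpoly2 set" where
  "homog k n = {f. Poly_Mapping.keys f \<subseteq> expos k n}"

definition scale2 :: "bit \<Rightarrow> mpoly2 \<Rightarrow> mpoly2" where
  "scale2 c f = Poly_Mapping.map ((*) c) f"

lemma lookup_scale2: "Poly_Mapping.lookup (scale2 c f) e = c * Poly_Mapping.lookup f e"
  unfolding scale2_def by transfer (simp add: when_def)

global_interpretation mp: vector_space scale2
proof
  fix a b :: bit and f g :: mpoly2
  show "scale2 a (f + g) = scale2 a f + scale2 a g"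
    by (rule poly_mapping_eqI) (simp only: lookup_scale2 lookup_add distrib_left)
  show "scale2 (a + b) f = scale2 a f + scale2 b f"
    by (rule poly_mapping_eqI) (simp only: lookup_scale2 lookup_add distrib_right)
  show "scale2 a (scale2 b f) = scale2 (a * b) f"
    by (rule poly_mapping_eqI) (simp only: lookup_scale2 mult.assoc)
  show "scale2 1 f = f"
    by (rule poly_mapping_eqI) (simp only: lookup_scale2 mult_1_left)
qed

definition lin_ext :: "(expo \<Rightarrow> mpoly2) \<Rightarrow> mpoly2 \<Rightarrow> mpoly2" where
  "lin_ext \<phi> f = (\<Sum>e\<in>Poly_Mapping.keys f. scale2 (Poly_Mapping.lookup f e) (\<phi> e))"

definition Sq :: "nat \<Rightarrow> nat \<Rightarrow> mpoly2 \<Rightarrow> mpoly2" where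
  "Sq k r = lin_ext (\<lambda>a. \<Sum>b\<in>expos k r.
     scale2 (of_nat (\<Prod>i=1..k. expo_at a i choose expo_at b i)) (xpow (a + b)))"

definition rho :: "nat \<Rightarrow> nat \<Rightarrow> nat" where
  "rho k n = mp.dim (Sq k 1 ` homog k n)"

text \<open>Only meaningful for \<open>e \<noteq> 0\<close>.\<close>

definition lead_idx :: "expo \<Rightarrow> nat" where
  "lead_idx e = Min {i. expo_at e i > 0}"

definition hmap :: "mpoly2 \<Rightarrow> mpoly2" where
  "hmap = lin_ext (\<lambda>e. if e \<noteq> 0 \<and> even (expo_at e (lead_idx e))
     then xpow (e - unit_expo (lead_idx e)) else 0)"

definition Tmon :: "nat \<Rightarrow> nat \<Rightarrow> expo set" where
  "Tmon k d = {e \<in> expos k d. odd (expo_at e (lead_idx e))}"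

definition Tspan :: "nat \<Rightarrow> nat \<Rightarrow> mpoly2 set" where
  "Tspan k d = mp.span (xpow ` Tmon k d)"

text \<open>
  The degree is not an argument: the map \<open>p\<^sub>d\<close> is the restriction of \<open>pmap k\<close> to \<open>homog k d\<close>.
\<close>

definition pmap :: "nat \<Rightarrow> mpoly2 \<Rightarrow> mpoly2" where
  "pmap k f = hmap (Sq k 1 f)"

definition fun_scale :: "'f::field \<Rightarrow> ('r \<Rightarrow> 'f) \<Rightarrow> 'r \<Rightarrow> 'f" where
  "fun_scale c v = (\<lambda>r. c * v r)"

global_interpretation fs: vector_space fun_scale
  by unfold_locales (auto simp: fun_scale_def distrib_left distrib_right mult.assoc fun_eq_iff)

text \<open>
  Rank (dimension of the column space) of a matrix \<open>A\<close> whose rows and columns are labelled by the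
  finite sets \<open>R\<close> and \<open>C\<close>; a column is extended by zero outside \<open>R\<close>.
\<close>

definition labelled_rank :: "'r set \<Rightarrow> 'c set \<Rightarrow> ('r \<Rightarrow> 'c \<Rightarrow> 'f::field) \<Rightarrow> nat" where
  "labelled_rank R C A = fs.dim ((\<lambda>c r. if r \<in> R then A r c else 0) ` C)"

definition hit_cols :: "nat \<Rightarrow> nat \<Rightarrow> (nat \<times> expo) set" where
  "hit_cols k d = {(t, g). 2 ^ t \<le> d \<and> g \<in> expos k (d - 2 ^ t)}"

definition hit_mat :: "nat \<Rightarrow> expo \<Rightarrow> nat \<times> expo \<Rightarrow> bit" where
  "hit_mat k r = (\<lambda>(t, g). Poly_Mapping.lookup (Sq k (2 ^ t) (xpow g)) r)"

definition rank_hit_mat :: "nat \<Rightarrow> nat \<Rightarrow> nat" where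
  "rank_hit_mat k d = labelled_rank (expos k d) (hit_cols k d) (hit_mat k)"

definition red_cols :: "nat \<Rightarrow> nat \<Rightarrow> (nat \<times> expo) set" where
  "red_cols k d = {(t, g). 1 \<le> t \<and> 2 ^ t \<le> d \<and> g \<in> expos k (d - 2 ^ t)}"

text \<open>
  The columns lie in \<open>Tspan k d\<close>, so restricting to the rows \<open>Tmon k d\<close> gives their coordinates in
  that basis.
\<close>

definition red_mat :: "nat \<Rightarrow> expo \<Rightarrow> nat \<times> expo \<Rightarrow> bit" where
  "red_mat k r = (\<lambda>(t, g). Poly_Mapping.lookup (pmap k (Sq k (2 ^ t) (xpow g))) r)"

definition rank_red_mat :: "nat \<Rightarrow> nat \<Rightarrow> nat" where
  "rank_red_mat k d = labelled_rank (Tmon k d) (red_cols k d) (red_mat k)"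

end

theory Submission imports Defs begin

text \<open>
  The theorem is the linear algebra of a contracting homotopy.  Write \<open>\<partial>\<close> for \<open>Sq k 1\<close> and \<open>h\<close> for
  \<^const>\<open>hmap\<close>.  Two facts about them carry everything.

  First, \<open>\<partial> Sq\<^sup>r = (r + 1) Sq\<^sup>r\<^sup>+\<^sup>1\<close> over the two-element field (lemma \<open>Sq1_Sq_xpow\<close>).  With
  \<open>r = 1\<close> this gives \<open>\<partial>\<partial> = 0\<close>; with \<open>r = 2\<^sup>t\<close>, \<open>t \<ge> 1\<close>, it identifies \<open>h \<partial> Sq\<^sup>r\<close> with
  \<open>h Sq\<^sup>r\<^sup>+\<^sup>1\<close>.

  Second, \<open>h \<partial> + \<partial> h = id\<close> in positive degrees (lemma \<open>homotopy\<close>).  The reason is visible on a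
  monomial \<open>x\<^sup>e\<close> with lowest variable \<open>x\<^sub>i\<close>: \<open>\<partial>\<close> raises one odd exponent at a time, and \<open>h\<close> lowers the
  exponent of \<open>x\<^sub>i\<close> when it is even.  If \<open>e\<^sub>i\<close> is odd, then \<open>h x\<^sup>e = 0\<close> and \<open>h \<partial> x\<^sup>e = x\<^sup>e\<close>, because
  only the term that raised \<open>e\<^sub>i\<close> survives.  If \<open>e\<^sub>i\<close> is even, \<open>\<partial> h x\<^sup>e\<close> consists of \<open>x\<^sup>e\<close>
  together with exactly the terms of \<open>h \<partial> x\<^sup>e\<close>, which cancel in characteristic two.

  Consequently \<open>p = h \<partial>\<close> satisfies \<open>\<partial> p = \<partial>\<close>, so it is idempotent, and its kernel in degree \<open>d\<close> is
  the image of \<open>\<partial>\<close>.  The monomial formula gives its image, and since \<open>h\<close> is injective on the image of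
  \<open>\<partial>\<close>, that image has the dimension \<open>rho k d\<close>.

  For the rank formula, the columns of the hit matrix with \<open>t = 0\<close> span the image of \<open>\<partial>\<close>, that is,
  all of the kernel of \<open>p\<close> in degree \<open>d\<close>.  Rank-nullity for \<open>p\<close> restricted to the column space of the
  hit matrix then splits its rank into \<open>rho k (d - 1)\<close> and the dimension of the span of the images of
  the columns with \<open>t \<ge> 1\<close>, which is the rank of the reduced matrix.
\<close>

section \<open>Dimension of images under linear maps\<close>

context vector_space_pair
begin

text \<open>
  The polynomials form an infinite-dimensional space, so this fact and rank-nullity below are stated
  for the span of a set instead of for a space with a finite basis.
\<close>

lemma dim_image_inj_on_span:
  assumes f: "Vector_Spaces.linear s1 s2 f" and inj: "inj_on f (vs1.span S)"
  shows "vs2.dim (f ` S) = vs1.dim S"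
proof -
  obtain B where B: "B \<subseteq> S" "vs1.independent B" "S \<subseteq> vs1.span B" "card B = vs1.dim S"
    using vs1.basis_exists by blast
  have BS: "vs1.span B \<subseteq> vs1.span S"
    using B(1) by (rule vs1.span_mono)
  have injB: "inj_on f (vs1.span B)"
    using inj BS by (rule inj_on_subset)
  show ?thesis
  proof (rule vs2.dim_unique)
    show "f ` B \<subseteq> f ` S" using B(1) by blast
    show "f ` S \<subseteq> vs2.span (f ` B)"
      using image_mono[OF B(3), of f] by (simp only: linear_span_image[OF f])
    show "vs2.independent (f ` B)"
      by (rule linear_independent_injective_image[OF f B(2) injB])
    show "card (f ` B) = vs1.dim S"
      using card_image[OF inj_on_subset[OF injB vs1.span_superset]] B(4) by simp
  qed
qed

text \<open>
  A basis \<open>B\<close> of the kernel inside the span of \<open>S\<close> extends to a basis \<open>A\<close> of that span, and \<open>f\<close> is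
  injective on the span of \<open>A - B\<close> because the spans of disjoint parts of a basis meet in \<open>0\<close>.
\<close>

lemma rank_nullity_on_span:
  assumes f: "Vector_Spaces.linear s1 s2 f" and fin: "finite S"
  shows "vs1.dim S = vs1.dim {x \<in> vs1.span S. f x = 0} + vs2.dim (f ` S)"
proof -
  let ?N = "{x \<in> vs1.span S. f x = 0}"
  obtain B where B: "B \<subseteq> ?N" "vs1.independent B" "?N \<subseteq> vs1.span B" "card B = vs1.dim ?N"
    using vs1.basis_exists by blast
  have "B \<subseteq> vs1.span S" using B(1) by blast
  then obtain A where A: "B \<subseteq> A" "A \<subseteq> vs1.span S" "vs1.independent A" "vs1.span S \<subseteq> vs1.span A"
    using vs1.maximal_independent_subset_extend[OF _ B(2)] by blast
  have finA: "finite A"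
    using vs1.independent_span_bound[OF fin A(3,2)] by simp
  let ?C = "A - B"
  have spanA: "vs1.span A = vs1.span S"
    using A(2,4) by (simp add: subset_antisym vs1.span_minimal)
  have indC: "vs1.independent ?C"
    using A(3) by (rule vs1.independent_mono) blast
  have ker: "x = 0" if x: "x \<in> vs1.span ?C" "f x = 0" for x
  proof -
    have "x \<in> vs1.span S"
      using x(1) spanA vs1.span_mono[of ?C A] by auto
    with x(2) B(3) have xB: "x \<in> vs1.span B" by blast
    have "vs1.representation A x = vs1.representation ?C x"
      by (rule vs1.representation_extend[OF A(3) x(1)]) blast
    moreover have "vs1.representation A x = vs1.representation B x"
      by (rule vs1.representation_extend[OF A(3) xB A(1)])
    ultimately have "vs1.representation A x b = 0" for b
      using vs1.representation_ne_zero[of ?C x b] vs1.representation_ne_zero[of B x b] by auto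
    moreover have "x \<in> vs1.span A" using \<open>x \<in> vs1.span S\<close> spanA by simp
    ultimately show "x = 0"
      using vs1.sum_nonzero_representation_eq[OF A(3), of x] by simp
  qed
  then have inj: "inj_on f (vs1.span ?C)"
    using linear_inj_on_iff_eq_0[OF f vs1.subspace_span] by blast
  have "vs2.span (f ` S) = vs2.span (f ` A)"
    using spanA by (simp add: linear_span_image[OF f])
  also have "\<dots> = vs2.span (f ` ?C)"
  proof -
    have "f ` A \<subseteq> insert 0 (f ` ?C)" using B(1) by blast
    also have "\<dots> \<subseteq> vs2.span (f ` ?C)"
      by (simp add: vs2.span_superset vs2.span_zero)
    finally have "f ` A \<subseteq> vs2.span (f ` ?C)" .
    moreover have "f ` ?C \<subseteq> vs2.span (f ` A)"
      using image_mono[of ?C A f] vs2.span_superset[of "f ` A"] by auto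
    ultimately show ?thesis by (simp only: vs2.span_eq)
  qed
  finally have "vs2.dim (f ` S) = vs2.dim (f ` ?C)"
    by (rule vs2.span_eq_dim)
  then have "vs2.dim (f ` S) = card ?C"
    using dim_image_inj_on_span[OF f inj] vs1.dim_eq_card_independent[OF indC] by simp
  moreover have "card A = vs1.dim S"
    using vs1.dim_eq_card[OF spanA A(3)] by simp
  moreover have "card A = card B + card ?C"
    using card_Un_disjoint[of B ?C] finA A(1)
    by (simp add: finite_subset[OF A(1) finA] Un_absorb1)
  ultimately show ?thesis
    using B(4) by simp
qed
end

section \<open>Linear maps determined on monomials\<close>

interpretation mp_pair: vector_space_pair scale2 scale2 ..

abbreviation (input) linear2 :: "(mpoly2 \<Rightarrow> mpoly2) \<Rightarrow> bool" where
  "linear2 \<equiv> Vector_Spaces.linear scale2 scale2"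

lemma of_nat_bit_eq_iff: "(of_nat m :: bit) = of_nat n \<longleftrightarrow> even m = even n"
  by (cases "even m"; cases "even n") (auto elim!: evenE oddE)

lemma scale2_eq: "scale2 c f = (if c = 1 then f else 0)"
  by (cases c) simp_all

lemma double_mpoly2: "(f :: mpoly2) + f = 0"
  by (rule poly_mapping_eqI) (simp only: lookup_add lookup_zero, simp)

lemma lookup_xpow: "Poly_Mapping.lookup (xpow e) r = (if r = e then 1 else 0)"
  by (simp add: xpow_def lookup_single when_def)

lemma xpow_expansion: "f = (\<Sum>e\<in>Poly_Mapping.keys f. scale2 (Poly_Mapping.lookup f e) (xpow e))"
  by (rule poly_mapping_eqI)
    (auto simp: lookup_sum lookup_scale2 lookup_xpow if_distrib[of "(*) _"] sum.delta' in_keys_iff cong: if_cong)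

lemma subspace_keys_subset: "mp.subspace {f. Poly_Mapping.keys f \<subseteq> E}"
  unfolding mp.subspace_def
  by (auto simp: in_keys_iff lookup_add lookup_scale2 subset_iff)

lemma span_xpow: "mp.span (xpow ` E) = {f. Poly_Mapping.keys f \<subseteq> E}"
proof
  show "mp.span (xpow ` E) \<subseteq> {f. Poly_Mapping.keys f \<subseteq> E}"
    by (rule mp.span_minimal[OF _ subspace_keys_subset]) (auto simp: xpow_def)
  show "{f. Poly_Mapping.keys f \<subseteq> E} \<subseteq> mp.span (xpow ` E)"
  proof clarify
    fix f :: mpoly2 assume "Poly_Mapping.keys f \<subseteq> E"
    then show "f \<in> mp.span (xpow ` E)"
      by (subst xpow_expansion) (intro mp.span_sum mp.span_scale mp.span_base, blast)
  qed
qed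

lemma homog_eq_span: "homog k n = mp.span (xpow ` expos k n)"
  by (simp add: homog_def span_xpow)

lemma subspace_homog: "mp.subspace (homog k n)"
  by (simp add: homog_eq_span)

lemma xpow_in_homog: "e \<in> expos k n \<Longrightarrow> xpow e \<in> homog k n"
  by (simp add: homog_eq_span mp.span_base)

lemma lin_ext_superset:
  assumes "finite E" "Poly_Mapping.keys f \<subseteq> E"
  shows "lin_ext \<phi> f = (\<Sum>e\<in>E. scale2 (Poly_Mapping.lookup f e) (\<phi> e))"
  unfolding lin_ext_def
  by (rule sum.mono_neutral_left) (use assms in \<open>auto simp: in_keys_iff\<close>)

lemma linear_lin_ext: "linear2 (lin_ext \<phi>)"
  unfolding Vector_Spaces.linear_iff
proof (intro conjI allI)
  show "vector_space scale2" "vector_space scale2" by unfold_locales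
  fix f g :: mpoly2 and c :: bit
  let ?E = "Poly_Mapping.keys f \<union> Poly_Mapping.keys g"
  have "lin_ext \<phi> (f + g) = (\<Sum>e\<in>?E. scale2 (Poly_Mapping.lookup (f + g) e) (\<phi> e))"
    by (rule lin_ext_superset) (simp_all add: Poly_Mapping.keys_add)
  also have "\<dots> = (\<Sum>e\<in>?E. scale2 (Poly_Mapping.lookup f e) (\<phi> e))
      + (\<Sum>e\<in>?E. scale2 (Poly_Mapping.lookup g e) (\<phi> e))"
    by (simp only: lookup_add mp.scale_left_distrib sum.distrib)
  finally show "lin_ext \<phi> (f + g) = lin_ext \<phi> f + lin_ext \<phi> g"
    by (simp add: lin_ext_superset[of ?E])
  have "lin_ext \<phi> (scale2 c f)
      = (\<Sum>e\<in>Poly_Mapping.keys f. scale2 (Poly_Mapping.lookup (scale2 c f) e) (\<phi> e))"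
    by (intro lin_ext_superset) (auto simp: lookup_scale2 in_keys_iff)
  also have "\<dots> = scale2 c (lin_ext \<phi> f)"
    by (simp only: lin_ext_def lookup_scale2 mp.scale_sum_right mp.scale_scale)
  finally show "lin_ext \<phi> (scale2 c f) = scale2 c (lin_ext \<phi> f)" .
qed

lemma lin_ext_xpow: "lin_ext \<phi> (xpow e) = \<phi> e"
  by (simp add: lin_ext_def xpow_def)

lemma linear_Sq: "linear2 (Sq k r)"
  by (simp only: Sq_def linear_lin_ext)

lemma linear_hmap: "linear2 hmap"
  by (simp only: hmap_def linear_lin_ext)

lemma linear_pmap: "linear2 (pmap k)"
  using Vector_Spaces.linear_compose[OF linear_Sq linear_hmap]
  by (simp add: pmap_def[abs_def] comp_def)

lemmas Sq_sum = mp_pair.linear_sum[OF linear_Sq]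
  and Sq_scale = mp_pair.linear_scale[OF linear_Sq]
  and Sq_zero = mp_pair.linear_0[OF linear_Sq]
  and hmap_sum = mp_pair.linear_sum[OF linear_hmap]
  and hmap_zero = mp_pair.linear_0[OF linear_hmap]

text \<open>
  Together with the expansion into monomials, this reduces an identity of linear maps on a homogeneous
  part to a computation on monomials, and the next lemma does the same for containment in a subspace.
\<close>

lemma linear_eq_on_xpow:
  assumes "linear2 \<phi>" "linear2 \<psi>" "f \<in> mp.span (xpow ` E)"
    and "\<And>e. e \<in> E \<Longrightarrow> \<phi> (xpow e) = \<psi> (xpow e)"
  shows "\<phi> f = \<psi> f"
  using mp_pair.linear_eq_on[OF assms(1-3)] assms(4) by blast

lemma linear_maps_span_into:
  assumes f: "linear2 \<phi>" and "mp.subspace W" "f \<in> mp.span (xpow ` E)"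
    and "\<And>e. e \<in> E \<Longrightarrow> \<phi> (xpow e) \<in> W"
  shows "\<phi> f \<in> W"
proof -
  have "\<phi> f \<in> mp.span (\<phi> ` xpow ` E)"
    using assms(3) by (simp add: mp_pair.linear_span_image[OF f])
  also have "\<dots> \<subseteq> W"
    by (rule mp.span_minimal) (use assms in auto)
  finally show ?thesis .
qed

section \<open>Exponent vectors of a given degree\<close>

lemma finite_expos: "finite (expos k n)"
proof -
  let ?F = "{f. \<forall>i. (i \<in> {1..k} \<longrightarrow> f i \<in> {..n}) \<and> (i \<notin> {1..k} \<longrightarrow> f i = (0::nat))}"
  have "finite ?F" by (rule finite_set_of_finite_funs) auto
  moreover have "expo_at ` expos k n \<subseteq> ?F"
  proof (clarify)
    fix e i assume e: "e \<in> expos k n"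
    show "(i \<in> {1..k} \<longrightarrow> expo_at e i \<in> {..n}) \<and> (i \<notin> {1..k} \<longrightarrow> expo_at e i = 0)"
      using e member_le_sum[of i "{1..k}" "expo_at e"]
      by (auto simp: expos_def in_keys_iff subset_iff)
  qed
  moreover have "inj_on expo_at (expos k n)"
    by (intro inj_onI poly_mapping_eqI) simp
  ultimately show ?thesis
    by (meson finite_imageD finite_subset)
qed

lemma add_in_expos: "a \<in> expos k m \<Longrightarrow> b \<in> expos k n \<Longrightarrow> a + b \<in> expos k (m + n)"
  using keys_add[of a b] by (auto simp: expos_def lookup_add sum.distrib)

lemma unit_expo_in_expos: "j \<in> {1..k} \<Longrightarrow> unit_expo j \<in> expos k 1"
  by (auto simp: expos_def unit_expo_def lookup_single when_def)

lemma expo_at_unit_expo: "expo_at (unit_expo i) j = (if j = i then 1 else 0)"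
  by (simp add: unit_expo_def lookup_single when_def)

lemma unit_expo_split: "0 < expo_at e j \<Longrightarrow> e = (e - unit_expo j) + unit_expo j"
  by (rule poly_mapping_eqI) (simp add: lookup_add lookup_minus expo_at_unit_expo)

lemma minus_unit_in_expos:
  assumes e: "e \<in> expos k (Suc n)" and j: "expo_at e j > 0"
  shows "e - unit_expo j \<in> expos k n"
proof -
  have jk: "j \<in> {1..k}" using e j by (auto simp: expos_def in_keys_iff subset_iff)
  have "sum (expo_at e) {1..k} = sum (expo_at (e - unit_expo j)) {1..k} + 1"
    using jk by (subst unit_expo_split[OF j]) (simp add: lookup_add sum.distrib expo_at_unit_expo)
  moreover have "Poly_Mapping.keys (e - unit_expo j) \<subseteq> Poly_Mapping.keys e"
    by (rule subsetI) (simp add: in_keys_iff lookup_minus)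
  ultimately show ?thesis
    using e unfolding expos_def by auto
qed

lemma expos_1: "expos k 1 = unit_expo ` {1..k}"
proof
  show "expos k 1 \<subseteq> unit_expo ` {1..k}"
  proof
    fix e assume e: "e \<in> expos k 1"
    then have "sum (expo_at e) {1..k} \<noteq> 0"
      by (simp add: expos_def)
    then obtain j where j: "j \<in> {1..k}" "expo_at e j \<noteq> 0"
      by (meson sum.neutral)
    then have "e - unit_expo j \<in> expos k 0"
      using minus_unit_in_expos[of e k 0 j] e by simp
    then have "Poly_Mapping.keys (e - unit_expo j) \<subseteq> {1..k}"
      "\<forall>i\<in>{1..k}. expo_at (e - unit_expo j) i = 0"
      by (simp_all add: expos_def)
    then have "Poly_Mapping.keys (e - unit_expo j) = {}"
      using in_keys_iff by fastforce
    then have "e = unit_expo j"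
      using unit_expo_split[of e j] j by simp
    with j show "e \<in> unit_expo ` {1..k}" by blast
  qed
qed (use unit_expo_in_expos in blast)

section \<open>Compositions with the first Steenrod square\<close>

lemma Sq_xpow: "Sq k r (xpow a) = (\<Sum>b\<in>expos k r.
    scale2 (of_nat (\<Prod>i=1..k. expo_at a i choose expo_at b i)) (xpow (a + b)))"
  by (simp add: Sq_def lin_ext_xpow)

lemma inj_unit_expo: "inj unit_expo"
  by (rule injI) (metis expo_at_unit_expo zero_neq_one)

lemma prod_choose_unit_expo:
  assumes "j \<in> {1..k}"
  shows "(\<Prod>i=1..k. expo_at a i choose expo_at (unit_expo j) i) = expo_at a j"
proof -
  have "(\<Prod>i=1..k. expo_at a i choose expo_at (unit_expo j) i)
      = (\<Prod>i=1..k. if i = j then expo_at a j else 1)"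
    by (intro prod.cong) (auto simp: expo_at_unit_expo)
  with assms show ?thesis by simp
qed

lemma Sq1_xpow_scaled:
  "Sq k 1 (xpow a) = (\<Sum>j=1..k. scale2 (of_nat (expo_at a j)) (xpow (a + unit_expo j)))"
proof -
  have "Sq k 1 (xpow a) = (\<Sum>b\<in>unit_expo ` {1..k}.
      scale2 (of_nat (\<Prod>i=1..k. expo_at a i choose expo_at b i)) (xpow (a + b)))"
    by (simp only: Sq_xpow expos_1)
  also have "\<dots> = (\<Sum>j=1..k. scale2 (of_nat (expo_at a j)) (xpow (a + unit_expo j)))"
    by (subst sum.reindex[OF inj_on_subset[OF inj_unit_expo subset_UNIV]])
      (intro sum.cong, simp_all only: o_def prod_choose_unit_expo)
  finally show ?thesis .
qed

lemma Sq1_xpow: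
  "Sq k 1 (xpow a) = (\<Sum>j | j \<in> {1..k} \<and> odd (expo_at a j). xpow (a + unit_expo j))"
proof -
  have "Sq k 1 (xpow a) = (\<Sum>j=1..k. if odd (expo_at a j) then xpow (a + unit_expo j) else 0)"
    unfolding Sq1_xpow_scaled
    by (intro sum.cong refl) (auto simp: scale2_eq of_nat_bit_eq_iff[of _ 1, simplified])
  also have "\<dots> = (\<Sum>j\<in>{j\<in>{1..k}. odd (expo_at a j)}. xpow (a + unit_expo j))"
    by (rule sum.inter_filter[symmetric]) simp
  finally show ?thesis by simp
qed

lemma Sq_homog:
  assumes "f \<in> homog k n"
  shows "Sq k r f \<in> homog k (n + r)"
proof (rule linear_maps_span_into[OF linear_Sq subspace_homog])
  show "f \<in> mp.span (xpow ` expos k n)"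
    using assms by (simp add: homog_eq_span)
  fix e assume "e \<in> expos k n"
  then show "Sq k r (xpow e) \<in> homog k (n + r)"
    unfolding Sq_xpow
    by (intro mp.subspace_sum mp.subspace_scale subspace_homog xpow_in_homog add_in_expos)
qed

text \<open>
  For \<open>c = m + 1 \<le> a + 1\<close> the absorption identity \<open>(m + 1) (a choose (m + 1)) = (a - m) (a choose m)\<close>
  applies, and \<open>a - m\<close> and \<open>a + m\<close> have the same parity; for larger \<open>c\<close> both sides vanish.
\<close>

lemma choose_pred_parity:
  assumes "0 < c"
  shows "even ((a choose (c - 1)) * (a + (c - 1))) = even (c * (a choose c))"
proof -
  obtain m where c: "c = Suc m" using assms by (cases c) auto
  show ?thesis
  proof (cases "m \<le> a")
    case True
    have "Suc m * (a choose Suc m) = (a choose m) * (a - m)"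
      using binomial_absorb_comp[of a m] Suc_times_binomial_eq[of "a - 1" m] True
      by (cases a) (auto simp: algebra_simps)
    moreover have "even (a + m) = even (a - m)" using True by auto
    ultimately show ?thesis by (simp add: c)
  next
    case False
    then show ?thesis by (simp add: c binomial_eq_0)
  qed
qed

text \<open>
  The left side is the coefficient with which \<open>x\<^sup>a\<^sup>+\<^sup>c\<close> arises in \<open>Sq\<^sup>1 Sq\<^sup>r x\<^sup>a\<close> when the square of
  degree \<open>1\<close> acts last on the variable \<open>x\<^sub>j\<close>.  Only the factor at \<open>j\<close> differs between the products.
\<close>

lemma prod_choose_shift_parity:
  assumes j: "j \<in> {1..k}" and c: "0 < expo_at c j"
  shows "even ((\<Prod>i=1..k. expo_at a i choose expo_at (c - unit_expo j) i)
        * (expo_at a j + expo_at (c - unit_expo j) j))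
    = even (expo_at c j * (\<Prod>i=1..k. expo_at a i choose expo_at c i))"
proof -
  let ?R = "\<Prod>i\<in>{1..k}-{j}. expo_at a i choose expo_at c i"
  have "(\<Prod>i=1..k. expo_at a i choose expo_at (c - unit_expo j) i)
      = (expo_at a j choose (expo_at c j - 1))
        * (\<Prod>i\<in>{1..k}-{j}. expo_at a i choose expo_at (c - unit_expo j) i)"
    using j by (subst prod.remove[of _ j]) (auto simp: lookup_minus expo_at_unit_expo)
  also have "(\<Prod>i\<in>{1..k}-{j}. expo_at a i choose expo_at (c - unit_expo j) i) = ?R"
    by (intro prod.cong) (auto simp: lookup_minus expo_at_unit_expo)
  finally have 1: "(\<Prod>i=1..k. expo_at a i choose expo_at (c - unit_expo j) i)
      = (expo_at a j choose (expo_at c j - 1)) * ?R" .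
  have 2: "(\<Prod>i=1..k. expo_at a i choose expo_at c i) = (expo_at a j choose expo_at c j) * ?R"
    using j by (subst prod.remove[of _ j]) auto
  have 3: "expo_at (c - unit_expo j) j = expo_at c j - 1"
    by (simp add: lookup_minus expo_at_unit_expo)
  show ?thesis
    using choose_pred_parity[OF c, of "expo_at a j"] unfolding 1 2 3 by auto
qed

text \<open>
  The coefficient of \<open>x\<^sup>a\<^sup>+\<^sup>c\<close> on the left is a sum over the variable \<open>j\<close> raised last.  By the
  preceding parity lemma each summand is \<open>c\<^sub>j\<close> times the coefficient of \<open>x\<^sup>a\<^sup>+\<^sup>c\<close> in \<open>Sq\<^sup>r\<^sup>+\<^sup>1 x\<^sup>a\<close>, and the
  \<open>c\<^sub>j\<close> add up to \<open>r + 1\<close>.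
\<close>

lemma Sq1_Sq_xpow:
  "Sq k 1 (Sq k r (xpow a)) = scale2 (of_nat (Suc r)) (Sq k (Suc r) (xpow a))"
proof -
  let ?P = "\<lambda>b. \<Prod>i=1..k. expo_at a i choose expo_at b i"
  let ?L = "\<lambda>b j. scale2 (of_nat (?P b * (expo_at a j + expo_at b j))) (xpow (a + b + unit_expo j))"
  let ?M = "\<lambda>c j. scale2 (of_nat (expo_at c j * ?P c)) (xpow (a + c))"
  let ?D = "{(c, j). c \<in> expos k (Suc r) \<and> j \<in> {1..k} \<and> 0 < expo_at c j}"
  have "Sq k 1 (Sq k r (xpow a)) = (\<Sum>b\<in>expos k r. \<Sum>j=1..k. ?L b j)"
    by (simp only: Sq_xpow[of k r] Sq_sum Sq_scale Sq1_xpow_scaled mp.scale_sum_right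
        mp.scale_scale of_nat_mult lookup_add)
  also have "\<dots> = (\<Sum>(b, j)\<in>expos k r \<times> {1..k}. ?L b j)"
    by (rule sum.cartesian_product)
  \<comment> \<open>Substitute \<open>c = b + unit_expo j\<close>, which forces \<open>c\<^sub>j > 0\<close>.\<close>
  also have "\<dots> = (\<Sum>(c, j)\<in>?D. ?M c j)"
  proof (rule sum.reindex_bij_witness[where j = "\<lambda>(b, j). (b + unit_expo j, j)"
        and i = "\<lambda>(c, j). (c - unit_expo j, j)"])
    fix x assume x: "x \<in> expos k r \<times> {1..k}"
    obtain b j where [simp]: "x = (b, j)" by (cases x)
    show "(case case x of (b, j) \<Rightarrow> (b + unit_expo j, j) of (c, j) \<Rightarrow> (c - unit_expo j, j)) = x"
      by simp
    show "(case x of (b, j) \<Rightarrow> (b + unit_expo j, j)) \<in> ?D"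
      using x add_in_expos[of b k r "unit_expo j" 1] unit_expo_in_expos[of j k]
      by (auto simp: lookup_add expo_at_unit_expo)
    have "even (?P b * (expo_at a j + expo_at b j))
        = even (expo_at (b + unit_expo j) j * ?P (b + unit_expo j))"
      using prod_choose_shift_parity[of j k "b + unit_expo j" a] x
      by (simp add: lookup_add expo_at_unit_expo)
    then have "(of_nat (?P b * (expo_at a j + expo_at b j)) :: bit)
        = of_nat (expo_at (b + unit_expo j) j * ?P (b + unit_expo j))"
      by (simp only: of_nat_bit_eq_iff)
    then show "(case case x of (b, j) \<Rightarrow> (b + unit_expo j, j) of (c, j) \<Rightarrow> ?M c j)
        = (case x of (b, j) \<Rightarrow> ?L b j)"
      by (simp only: \<open>x = (b, j)\<close> prod.case add.assoc)
  next
    fix y assume y: "y \<in> ?D"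
    obtain c j where [simp]: "y = (c, j)" by (cases y)
    show "(case case y of (c, j) \<Rightarrow> (c - unit_expo j, j) of (b, j) \<Rightarrow> (b + unit_expo j, j)) = y"
      using y unit_expo_split[of c j] by simp
    show "(case y of (c, j) \<Rightarrow> (c - unit_expo j, j)) \<in> expos k r \<times> {1..k}"
      using y minus_unit_in_expos[of c k r j] by simp
  qed
  \<comment> \<open>The pairs with \<open>c\<^sub>j = 0\<close> contribute nothing, so the domain becomes a rectangle.\<close>
  also have "\<dots> = (\<Sum>(c, j)\<in>expos k (Suc r) \<times> {1..k}. ?M c j)"
    by (rule sum.mono_neutral_left) (auto simp: finite_expos intro!: gr0I)
  also have "\<dots> = (\<Sum>c\<in>expos k (Suc r). \<Sum>j=1..k. ?M c j)"
    by (rule sum.cartesian_product[symmetric])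
  also have "\<dots> = (\<Sum>c\<in>expos k (Suc r). scale2 (of_nat (Suc r * ?P c)) (xpow (a + c)))"
  proof (rule sum.cong[OF refl])
    fix c assume "c \<in> expos k (Suc r)"
    then have "(\<Sum>j=1..k. expo_at c j) = Suc r" by (simp add: expos_def)
    then have "Suc r * ?P c = (\<Sum>j=1..k. expo_at c j * ?P c)"
      by (simp only: sum_distrib_right[symmetric])
    then show "(\<Sum>j=1..k. ?M c j) = scale2 (of_nat (Suc r * ?P c)) (xpow (a + c))"
      by (simp only: mp.scale_sum_left of_nat_sum)
  qed
  also have "\<dots> = scale2 (of_nat (Suc r)) (Sq k (Suc r) (xpow a))"
    by (simp only: Sq_xpow mp.scale_sum_right mp.scale_scale of_nat_mult)
  finally show ?thesis .
qed

lemma Sq1_Sq1: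
  assumes "f \<in> homog k n"
  shows "Sq k 1 (Sq k 1 f) = 0"
proof -
  have "linear2 (\<lambda>f. Sq k 1 (Sq k 1 f))"
    using Vector_Spaces.linear_compose[OF linear_Sq linear_Sq] by (simp add: comp_def)
  then have "Sq k 1 (Sq k 1 f) \<in> {0}"
  proof (rule linear_maps_span_into)
    show "f \<in> mp.span (xpow ` expos k n)"
      using assms by (simp add: homog_eq_span)
    show "Sq k 1 (Sq k 1 (xpow e)) \<in> {0}" for e
      unfolding Sq1_Sq_xpow by (simp add: scale2_eq)
  qed (rule mp.subspace_single_0)
  then show ?thesis by simp
qed

section \<open>The lowest variable and the action on monomials\<close>

lemma lead_idx_expos:
  assumes e: "e \<in> expos k d" and d: "0 < d"
  shows "lead_idx e \<in> {1..k}" "0 < expo_at e (lead_idx e)"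
    "\<And>j. j < lead_idx e \<Longrightarrow> expo_at e j = 0"
proof -
  have keys: "{i. expo_at e i > 0} = Poly_Mapping.keys e"
    by (auto simp: in_keys_iff)
  have "sum (expo_at e) {1..k} \<noteq> 0" using e d by (simp add: expos_def)
  then have "Poly_Mapping.keys e \<noteq> {}"
    by (metis empty_iff in_keys_iff sum.neutral)
  then have "lead_idx e \<in> Poly_Mapping.keys e"
    unfolding lead_idx_def keys by (rule Min_in[OF finite_keys])
  moreover have "Poly_Mapping.keys e \<subseteq> {1..k}" using e by (simp add: expos_def)
  ultimately show "lead_idx e \<in> {1..k}" "0 < expo_at e (lead_idx e)"
    by (blast, simp add: in_keys_iff)
  fix j assume "j < lead_idx e"
  then show "expo_at e j = 0"
    unfolding lead_idx_def keys by (metis Min_le finite_keys in_keys_iff not_less)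
qed

lemma lead_idx_eqI:
  assumes "0 < expo_at e i" "\<And>j. j < i \<Longrightarrow> expo_at e j = 0"
  shows "lead_idx e = i"
proof -
  have "{i. expo_at e i > 0} = Poly_Mapping.keys e"
    by (auto simp: in_keys_iff)
  then show ?thesis
    unfolding lead_idx_def
    by (intro Min_eqI) (use assms in \<open>auto intro: leI\<close>)
qed

lemma hmap_xpow:
  "e \<in> expos k d \<Longrightarrow> 0 < d \<Longrightarrow>
    hmap (xpow e) = (if even (expo_at e (lead_idx e)) then xpow (e - unit_expo (lead_idx e)) else 0)"
  using lead_idx_expos(2)[of e k d] by (auto simp: hmap_def lin_ext_xpow)

lemma hmap_homog:
  assumes "f \<in> homog k (Suc n)"
  shows "hmap f \<in> homog k n"
proof (rule linear_maps_span_into[OF linear_hmap subspace_homog])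
  show "f \<in> mp.span (xpow ` expos k (Suc n))"
    using assms by (simp add: homog_eq_span)
  fix e assume e: "e \<in> expos k (Suc n)"
  then show "hmap (xpow e) \<in> homog k n"
    using lead_idx_expos(2)[OF e] mp.subspace_0[OF subspace_homog]
    by (auto simp: hmap_xpow[OF e] intro: xpow_in_homog minus_unit_in_expos)
qed

lemma pmap_homog: "f \<in> homog k d \<Longrightarrow> pmap k f \<in> homog k d"
  unfolding pmap_def using Sq_homog[of f k d 1] by (intro hmap_homog) simp

text \<open>
  Raising a positive exponent keeps the lowest variable, so \<open>h\<close> still acts at \<open>lead_idx e\<close> on every
  monomial of \<open>Sq\<^sup>1 x\<^sup>e\<close>.
\<close>

lemma hmap_raised_xpow:
  assumes e: "e \<in> expos k d" and d: "0 < d" and j: "j \<in> {1..k}" "odd (expo_at e j)"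
  shows "hmap (xpow (e + unit_expo j)) =
    (if even (expo_at (e + unit_expo j) (lead_idx e)) then xpow (e + unit_expo j - unit_expo (lead_idx e)) else 0)"
proof -
  have "expo_at e j \<noteq> 0" using j(2) by (metis even_zero)
  then have "lead_idx e \<le> j" using lead_idx_expos(3)[OF e d] by (metis not_le)
  then have "lead_idx (e + unit_expo j) = lead_idx e"
    using lead_idx_expos[OF e d]
    by (intro lead_idx_eqI) (auto simp: lookup_add expo_at_unit_expo)
  moreover have "e + unit_expo j \<in> expos k (d + 1)"
    by (intro add_in_expos e unit_expo_in_expos j)
  ultimately show ?thesis by (simp add: hmap_xpow)
qed

text \<open>
  Every term of \<open>Sq\<^sup>1 x\<^sup>e\<close> that leaves an odd exponent at the lowest variable \<open>i\<close> is killed by \<open>h\<close>.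
  If \<open>e\<^sub>i\<close> is odd, this leaves only the term that raised \<open>e\<^sub>i\<close> itself; if \<open>e\<^sub>i\<close> is even, no term is
  killed.
\<close>

lemma pmap_xpow:
  assumes e: "e \<in> expos k d" and d: "0 < d"
  shows "pmap k (xpow e) =
          (if odd (expo_at e (lead_idx e)) then xpow e
           else \<Sum>j | j \<in> {1..k} \<and> j > lead_idx e \<and> odd (expo_at e j).
                  xpow (e - unit_expo (lead_idx e) + unit_expo j))"
proof -
  let ?i = "lead_idx e"
  let ?J = "{j. j \<in> {1..k} \<and> odd (expo_at e j)}"
  note lead = lead_idx_expos[OF e d]
  have p: "pmap k (xpow e) = (\<Sum>j\<in>?J. if even (expo_at (e + unit_expo j) ?i)
      then xpow (e + unit_expo j - unit_expo ?i) else 0)"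
    unfolding pmap_def Sq1_xpow hmap_sum
    by (rule sum.cong[OF refl]) (use hmap_raised_xpow[OF e d] in auto)
  show ?thesis
  proof (cases "odd (expo_at e ?i)")
    case True
    have "pmap k (xpow e) = (\<Sum>j\<in>?J. if j = ?i then xpow e else 0)"
      unfolding p by (rule sum.cong) (use True in \<open>auto simp: lookup_add expo_at_unit_expo\<close>)
    also have "\<dots> = xpow e"
      using True lead(1) by (simp add: sum.delta)
    finally show ?thesis using True by simp
  next
    case False
    have J: "?J = {j. j \<in> {1..k} \<and> j > ?i \<and> odd (expo_at e j)}"
      using False lead(3) by (metis even_zero linorder_neqE_nat)
    have "pmap k (xpow e) = (\<Sum>j\<in>?J. xpow (e - unit_expo ?i + unit_expo j))"
      unfolding p
    proof (rule sum.cong[OF refl])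
      fix j assume j: "j \<in> ?J"
      then have ne: "j \<noteq> ?i" using False by auto
      have "e + unit_expo j - unit_expo ?i = e - unit_expo ?i + unit_expo j"
        by (rule poly_mapping_eqI) (use lead(2) ne in \<open>simp add: lookup_add lookup_minus expo_at_unit_expo\<close>)
      then show "(if even (expo_at (e + unit_expo j) ?i) then xpow (e + unit_expo j - unit_expo ?i) else 0)
          = xpow (e - unit_expo ?i + unit_expo j)"
        using False ne by (simp add: lookup_add expo_at_unit_expo)
    qed
    then show ?thesis using False J by simp
  qed
qed

text \<open>
  When \<open>e\<^sub>i\<close> is even, \<open>h\<close> makes it odd while leaving the other exponents alone; hence \<open>Sq\<^sup>1 h x\<^sup>e\<close> has
  one term more than the formula for \<open>pmap k (xpow e)\<close>, namely \<open>x\<^sup>e\<close>, which restores \<open>e\<^sub>i\<close>.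
\<close>

lemma Sq1_hmap_xpow:
  assumes e: "e \<in> expos k d" and d: "0 < d"
  shows "pmap k (xpow e) + Sq k 1 (hmap (xpow e)) = xpow e"
proof (cases "odd (expo_at e (lead_idx e))")
  case True
  then show ?thesis by (simp add: pmap_xpow[OF e d] hmap_xpow[OF e d] Sq_zero)
next
  case False
  let ?i = "lead_idx e"
  let ?a = "e - unit_expo ?i"
  let ?J = "{j. j \<in> {1..k} \<and> j > ?i \<and> odd (expo_at e j)}"
  note lead = lead_idx_expos[OF e d]
  have "odd (expo_at ?a ?i)"
    using False lead(2) by (simp add: lookup_minus expo_at_unit_expo)
  moreover have "odd (expo_at ?a j) = (j > ?i \<and> odd (expo_at e j))" if "j \<noteq> ?i" for j
  proof -
    have "odd (expo_at e j) \<Longrightarrow> j > ?i"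
      using that lead(3) by (metis even_zero linorder_neqE_nat)
    then show ?thesis using that by (auto simp: lookup_minus expo_at_unit_expo)
  qed
  ultimately have odd_iff: "odd (expo_at ?a j) = (j = ?i \<or> j > ?i \<and> odd (expo_at e j))" for j
    by (cases "j = ?i") auto
  have J: "{j. j \<in> {1..k} \<and> odd (expo_at ?a j)} = insert ?i ?J"
    unfolding odd_iff using lead(1) by auto
  have "hmap (xpow e) = xpow ?a"
    using False by (simp add: hmap_xpow[OF e d])
  then have "Sq k 1 (hmap (xpow e)) = (\<Sum>j\<in>insert ?i ?J. xpow (?a + unit_expo j))"
    by (simp only: Sq1_xpow J)
  also have "\<dots> = xpow (?a + unit_expo ?i) + (\<Sum>j\<in>?J. xpow (?a + unit_expo j))"
    by (rule sum.insert) auto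
  also have "?a + unit_expo ?i = e"
    by (rule unit_expo_split[symmetric, OF lead(2)])
  also have "(\<Sum>j\<in>?J. xpow (?a + unit_expo j)) = pmap k (xpow e)"
    using False by (simp add: pmap_xpow[OF e d])
  finally show ?thesis
    using double_mpoly2[of "pmap k (xpow e)"]
    by (metis add.left_commute add.right_neutral)
qed

section \<open>The contracting homotopy and the projection\<close>

lemma homotopy:
  assumes f: "f \<in> homog k d" and d: "0 < d"
  shows "hmap (Sq k 1 f) + Sq k 1 (hmap f) = f"
proof (rule linear_eq_on_xpow)
  show "linear2 (\<lambda>f. hmap (Sq k 1 f) + Sq k 1 (hmap f))"
    using Vector_Spaces.linear_compose[OF linear_Sq linear_hmap]
      Vector_Spaces.linear_compose[OF linear_hmap linear_Sq]
    by (auto simp: comp_def intro: mp_pair.linear_compose_add)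
  show "linear2 (\<lambda>f. f)"
    by (rule mp.linear_ident)
  show "f \<in> mp.span (xpow ` expos k d)"
    using f by (simp add: homog_eq_span)
  show "hmap (Sq k 1 (xpow e)) + Sq k 1 (hmap (xpow e)) = xpow e" if "e \<in> expos k d" for e
    using Sq1_hmap_xpow[OF that d] by (simp add: pmap_def)
qed

text \<open>
  The homotopy applied to \<open>Sq\<^sup>1 f\<close>, whose first term vanishes since \<open>Sq\<^sup>1 Sq\<^sup>1 = 0\<close>.
\<close>

lemma Sq1_pmap:
  assumes "f \<in> homog k d"
  shows "Sq k 1 (pmap k f) = Sq k 1 f"
  using homotopy[of "Sq k 1 f" k "d + 1"] Sq_homog[OF assms, of 1] Sq1_Sq1[OF assms]
  by (simp add: pmap_def hmap_zero)

lemma pmap_idem: "f \<in> homog k d \<Longrightarrow> pmap k (pmap k f) = pmap k f"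
  using Sq1_pmap[of f k d] by (simp add: pmap_def)

lemma pmap_Sq1: "f \<in> homog k n \<Longrightarrow> pmap k (Sq k 1 f) = 0"
  by (simp only: pmap_def Sq1_Sq1 hmap_zero)

text \<open>
  If \<open>pmap k f = 0\<close>, the homotopy writes \<open>f\<close> as \<open>Sq\<^sup>1 (hmap f)\<close>; the converse is \<open>Sq\<^sup>1 Sq\<^sup>1 = 0\<close>.
\<close>

lemma kernel_pmap:
  assumes d: "0 < d"
  shows "{f \<in> homog k d. pmap k f = 0} = Sq k 1 ` homog k (d - 1)"
proof
  show "{f \<in> homog k d. pmap k f = 0} \<subseteq> Sq k 1 ` homog k (d - 1)"
  proof clarify
    fix f assume f: "f \<in> homog k d" "pmap k f = 0"
    then have "f = Sq k 1 (hmap f)"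
      using homotopy[OF f(1) d] by (simp add: pmap_def)
    moreover have "hmap f \<in> homog k (d - 1)"
      using f(1) d by (intro hmap_homog) simp
    ultimately show "f \<in> Sq k 1 ` homog k (d - 1)" by blast
  qed
  show "Sq k 1 ` homog k (d - 1) \<subseteq> {f \<in> homog k d. pmap k f = 0}"
    using Sq_homog[of _ k "d - 1" 1] pmap_Sq1[of _ k "d - 1"] d by auto
qed

text \<open>
  In the formula for a monomial with \<open>e\<^sub>i\<close> even, every term has the odd exponent \<open>e\<^sub>i - 1 > 0\<close> at \<open>i\<close>,
  which remains its lowest variable; and \<open>pmap\<close> fixes the monomials of \<^const>\<open>Tmon\<close>.
\<close>

lemma image_pmap:
  assumes d: "0 < d"
  shows "pmap k ` homog k d = Tspan k d"
proof
  show "pmap k ` homog k d \<subseteq> Tspan k d"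
  proof clarify
    fix f assume "f \<in> homog k d"
    then have "f \<in> mp.span (xpow ` expos k d)" by (simp add: homog_eq_span)
    with linear_pmap _ show "pmap k f \<in> Tspan k d"
    proof (rule linear_maps_span_into)
      show "mp.subspace (Tspan k d)" by (simp add: Tspan_def)
      fix e assume e: "e \<in> expos k d"
      let ?i = "lead_idx e"
      note lead = lead_idx_expos[OF e d]
      show "pmap k (xpow e) \<in> Tspan k d"
      proof (cases "odd (expo_at e ?i)")
        case True
        then show ?thesis
          using e by (simp add: pmap_xpow[OF e d] Tspan_def Tmon_def mp.span_base)
      next
        case False
        have "e - unit_expo ?i + unit_expo j \<in> Tmon k d" if j: "j \<in> {1..k}" "j > ?i" for j
        proof -
          have "e - unit_expo ?i \<in> expos k (d - 1)"
            using minus_unit_in_expos[of e k "d - 1" ?i] e d lead(2) by simp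
          then have "e - unit_expo ?i + unit_expo j \<in> expos k (d - 1 + 1)"
            by (intro add_in_expos unit_expo_in_expos j)
          moreover have at: "expo_at (e - unit_expo ?i + unit_expo j) ?i = expo_at e ?i - 1"
            using j by (simp add: lookup_add lookup_minus expo_at_unit_expo)
          moreover have odd: "odd (expo_at e ?i - 1)" using False lead(2) by simp
          moreover have "lead_idx (e - unit_expo ?i + unit_expo j) = ?i"
          proof (rule lead_idx_eqI)
            show "0 < expo_at (e - unit_expo ?i + unit_expo j) ?i"
              using odd_pos[OF odd] by (simp only: at)
          qed (use lead(3) j in \<open>simp add: lookup_add lookup_minus expo_at_unit_expo\<close>)
          ultimately show ?thesis using d by (simp add: Tmon_def)
        qed
        then show ?thesis
          using False unfolding pmap_xpow[OF e d] Tspan_def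
          by (simp only: if_False) (intro mp.span_sum mp.span_base imageI, simp)
      qed
    qed
  qed
  show "Tspan k d \<subseteq> pmap k ` homog k d"
    unfolding Tspan_def
  proof (rule mp.span_minimal)
    show "mp.subspace (pmap k ` homog k d)"
      by (rule mp_pair.linear_subspace_image[OF linear_pmap subspace_homog])
    show "xpow ` Tmon k d \<subseteq> pmap k ` homog k d"
    proof clarify
      fix e assume "e \<in> Tmon k d"
      then have e: "e \<in> expos k d" "odd (expo_at e (lead_idx e))" by (auto simp: Tmon_def)
      then have "xpow e = pmap k (xpow e)" by (simp add: pmap_xpow[OF e(1) d])
      with xpow_in_homog[OF e(1)] show "xpow e \<in> pmap k ` homog k d" by blast
    qed
  qed
qed

text \<open>
  The projection factors through the image of \<open>Sq\<^sup>1\<close>, on which \<open>h\<close> is injective, because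
  \<open>Sq\<^sup>1 h Sq\<^sup>1 = Sq\<^sup>1\<close> recovers an element of that image from its value under \<open>h\<close>.
\<close>

lemma dim_Tspan:
  assumes d: "0 < d"
  shows "mp.dim (Tspan k d) = rho k d"
proof -
  let ?B = "Sq k 1 ` homog k d"
  have sub: "mp.subspace ?B"
    by (rule mp_pair.linear_subspace_image[OF linear_Sq subspace_homog])
  have "inj_on hmap (mp.span ?B)"
    unfolding mp.span_eq_iff[THEN iffD2, OF sub] mp_pair.linear_inj_on_iff_eq_0[OF linear_hmap sub]
  proof clarify
    fix f assume f: "f \<in> homog k d" "hmap (Sq k 1 f) = 0"
    then have "Sq k 1 f = Sq k 1 (pmap k f)" by (simp only: Sq1_pmap)
    also have "\<dots> = 0" using f(2) by (simp add: pmap_def Sq_zero)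
    finally show "Sq k 1 f = 0" .
  qed
  then have "mp.dim (hmap ` ?B) = mp.dim ?B"
    by (rule mp_pair.dim_image_inj_on_span[OF linear_hmap])
  moreover have "hmap ` ?B = Tspan k d"
    using image_pmap[OF d, of k] by (simp add: pmap_def image_image)
  ultimately show ?thesis by (simp add: rho_def)
qed

lemma pmap_Sq_even:
  assumes "even r"
  shows "pmap k (Sq k r (xpow g)) = hmap (Sq k (r + 1) (xpow g))"
proof -
  have "(of_nat (Suc r) :: bit) = of_nat 1"
    unfolding of_nat_bit_eq_iff using assms by simp
  then have "Sq k 1 (Sq k r (xpow g)) = Sq k (r + 1) (xpow g)"
    unfolding Sq1_Sq_xpow by (simp add: scale2_eq)
  then show ?thesis by (simp add: pmap_def)
qed

section \<open>Ranks of the hit matrix and the reduced matrix\<close>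

text \<open>
  The columns whose span defines \<^const>\<open>labelled_rank\<close> are the values of this map, so ranks of
  matrices become dimensions of spans of polynomials.
\<close>

definition coordinates :: "expo set \<Rightarrow> mpoly2 \<Rightarrow> expo \<Rightarrow> bit" where
  "coordinates R f = (\<lambda>r. if r \<in> R then Poly_Mapping.lookup f r else 0)"

lemma linear_coordinates: "Vector_Spaces.linear scale2 fun_scale (coordinates R)"
  unfolding Vector_Spaces.linear_iff
  by (intro conjI allI mp.vector_space_axioms fs.vector_space_axioms)
    (simp_all only: coordinates_def lookup_add lookup_scale2 fun_scale_def fun_eq_iff plus_fun_def, simp_all)

interpretation mp_fs: vector_space_pair scale2 "fun_scale :: bit \<Rightarrow> (expo \<Rightarrow> bit) \<Rightarrow> expo \<Rightarrow> bit" ..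

lemma dim_coordinates:
  assumes "S \<subseteq> mp.span (xpow ` R)"
  shows "fs.dim (coordinates R ` S) = mp.dim S"
proof (rule mp_fs.dim_image_inj_on_span[OF linear_coordinates])
  have "inj_on (coordinates R) {f. Poly_Mapping.keys f \<subseteq> R}"
  proof (rule inj_onI)
    fix f g :: mpoly2
    assume "f \<in> {f. Poly_Mapping.keys f \<subseteq> R}" "g \<in> {f. Poly_Mapping.keys f \<subseteq> R}"
      and eq: "coordinates R f = coordinates R g"
    then have off: "Poly_Mapping.lookup f r = Poly_Mapping.lookup g r" if "r \<notin> R" for r
      using that by (metis in_keys_iff mem_Collect_eq subsetD)
    show "f = g"
    proof (rule poly_mapping_eqI)
      fix r show "Poly_Mapping.lookup f r = Poly_Mapping.lookup g r"
        using off fun_cong[OF eq, of r] by (cases "r \<in> R") (simp_all add: coordinates_def)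
    qed
  qed
  then show "inj_on (coordinates R) (mp.span S)"
    using mp.span_minimal[OF assms mp.subspace_span] unfolding span_xpow by (rule inj_on_subset)
qed

definition hit_column :: "nat \<Rightarrow> nat \<times> expo \<Rightarrow> mpoly2" where
  "hit_column k = (\<lambda>(t, g). Sq k (2 ^ t) (xpow g))"

lemma hit_column_homog: "hit_column k ` hit_cols k d \<subseteq> homog k d"
proof clarify
  fix t g assume "(t, g) \<in> hit_cols k d"
  then have "2 ^ t \<le> d" "g \<in> expos k (d - 2 ^ t)" by (auto simp: hit_cols_def)
  then show "hit_column k (t, g) \<in> homog k d"
    using Sq_homog[OF xpow_in_homog, of g k "d - 2 ^ t" "2 ^ t"] by (simp add: hit_column_def)
qed

lemma rank_hit_mat_eq_dim: "rank_hit_mat k d = mp.dim (hit_column k ` hit_cols k d)"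
proof -
  have "fs.dim (coordinates (expos k d) ` hit_column k ` hit_cols k d)
      = mp.dim (hit_column k ` hit_cols k d)"
    using hit_column_homog unfolding homog_eq_span by (rule dim_coordinates)
  then show ?thesis
    by (simp add: rank_hit_mat_def labelled_rank_def image_image coordinates_def hit_mat_def
        hit_column_def case_prod_unfold cong: if_cong)
qed

lemma rank_red_mat_eq_dim:
  assumes "0 < d"
  shows "rank_red_mat k d = mp.dim (pmap k ` hit_column k ` red_cols k d)"
proof -
  have "red_cols k d \<subseteq> hit_cols k d"
    by (auto simp: red_cols_def hit_cols_def)
  then have "hit_column k ` red_cols k d \<subseteq> homog k d"
    using hit_column_homog[of k d] by blast
  then have "pmap k ` hit_column k ` red_cols k d \<subseteq> Tspan k d"
    using image_pmap[OF assms, of k] by blast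
  then have "fs.dim (coordinates (Tmon k d) ` pmap k ` hit_column k ` red_cols k d)
      = mp.dim (pmap k ` hit_column k ` red_cols k d)"
    unfolding Tspan_def by (rule dim_coordinates)
  then show ?thesis
    by (simp add: rank_red_mat_def labelled_rank_def image_image coordinates_def red_mat_def
        hit_column_def case_prod_unfold cong: if_cong)
qed

lemma finite_hit_cols: "finite (hit_cols k d)"
proof (rule finite_subset)
  show "hit_cols k d \<subseteq> (SIGMA t:{..d}. expos k (d - 2 ^ t))"
  proof clarify
    fix t g assume "(t, g) \<in> hit_cols k d"
    then have "2 ^ t \<le> d" "g \<in> expos k (d - 2 ^ t)" by (auto simp: hit_cols_def)
    then show "t \<in> {..d} \<and> g \<in> expos k (d - 2 ^ t)"
      using less_le_trans[OF less_exp, of t d] by simp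
  qed
  show "finite (SIGMA t:{..d}. expos k (d - 2 ^ t))"
    by (intro finite_SigmaI finite_expos) simp
qed

lemma hit_cols_split:
  assumes "0 < d"
  shows "hit_cols k d = {0} \<times> expos k (d - 1) \<union> red_cols k d"
proof (intro set_eqI)
  fix c :: "nat \<times> expo"
  obtain t g where "c = (t, g)" by (cases c)
  then show "c \<in> hit_cols k d \<longleftrightarrow> c \<in> {0} \<times> expos k (d - 1) \<union> red_cols k d"
    using assms by (cases t) (auto simp: hit_cols_def red_cols_def)
qed

text \<open>
  Rank-nullity for \<^const>\<open>pmap\<close> on the span of the columns of the hit matrix.  That span contains the whole
  kernel of \<^const>\<open>pmap\<close> in degree \<open>d\<close>, since the columns with \<open>t = 0\<close> already span it; the same
  columns are sent to \<open>0\<close>, so they do not contribute to the rank of the image.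
\<close>

lemma rank_hit_mat_split:
  assumes d: "0 < d"
  shows "rank_hit_mat k d = rho k (d - 1) + rank_red_mat k d"
proof -
  let ?S = "hit_column k ` hit_cols k d"
  let ?B = "Sq k 1 ` homog k (d - 1)"
  let ?C = "Sq k 1 ` xpow ` expos k (d - 1)"
  let ?S' = "hit_column k ` red_cols k d"
  have S: "?S = ?C \<union> ?S'"
  proof -
    have "hit_column k (0, g) = Sq k 1 (xpow g)" for g
      by (simp add: hit_column_def)
    then have "hit_column k ` ({0} \<times> expos k (d - 1)) = ?C"
      by (force simp: image_iff)
    then show ?thesis by (simp only: hit_cols_split[OF d] image_Un)
  qed
  have spanC: "mp.span ?C = ?B"
    by (simp add: homog_eq_span mp_pair.linear_span_image[OF linear_Sq])
  have S_homog: "mp.span ?S \<subseteq> homog k d"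
    by (rule mp.span_minimal[OF hit_column_homog subspace_homog])
  have "{f \<in> mp.span ?S. pmap k f = 0} = ?B"
  proof
    show "{f \<in> mp.span ?S. pmap k f = 0} \<subseteq> ?B"
      unfolding kernel_pmap[OF d, symmetric] using S_homog by blast
    have "?B \<subseteq> mp.span ?S"
      unfolding spanC[symmetric] S by (rule mp.span_mono) simp
    then show "?B \<subseteq> {f \<in> mp.span ?S. pmap k f = 0}"
      using kernel_pmap[OF d, of k] by blast
  qed
  then have rn: "mp.dim ?S = mp.dim ?B + mp.dim (pmap k ` ?S)"
    using mp_pair.rank_nullity_on_span[OF linear_pmap, of ?S k]
    by (simp only: finite_imageI[OF finite_hit_cols])
  have "mp.dim (pmap k ` ?S) = mp.dim (pmap k ` ?S')"
  proof (rule mp.span_eq_dim)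
    have "pmap k ` ?C \<subseteq> {0}"
      using pmap_Sq1[OF xpow_in_homog] by auto
    then have "pmap k ` ?S \<subseteq> insert 0 (pmap k ` ?S')"
      unfolding S image_Un by blast
    also have "\<dots> \<subseteq> mp.span (pmap k ` ?S')"
      by (simp add: mp.span_superset mp.span_zero)
    finally have "pmap k ` ?S \<subseteq> mp.span (pmap k ` ?S')" .
    moreover have "pmap k ` ?S' \<subseteq> mp.span (pmap k ` ?S)"
      unfolding S by (rule order.trans[OF _ mp.span_superset]) blast
    ultimately show "mp.span (pmap k ` ?S) = mp.span (pmap k ` ?S')"
      by (simp only: mp.span_eq)
  qed
  with rn show ?thesis
    by (simp add: rank_hit_mat_eq_dim rank_red_mat_eq_dim[OF d] rho_def)
qed

theorem theorem5p1:
  fixes k d :: nat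
  assumes "1 \<le> k" and "0 < d"
  shows
    "Vector_Spaces.linear scale2 scale2 (pmap k)
     \<and> pmap k ` homog k d \<subseteq> homog k d
     \<and> (\<forall>f\<in>homog k d. pmap k (pmap k f) = pmap k f)
     \<and> pmap k ` homog k d = Tspan k d
     \<and> {f \<in> homog k d. pmap k f = 0} = Sq k 1 ` homog k (d - 1)
     \<and> mp.dim (Tspan k d) = rho k d
     \<and> (\<forall>e\<in>expos k d. pmap k (xpow e) =
          (if odd (expo_at e (lead_idx e)) then xpow e
           else \<Sum>j | j \<in> {1..k} \<and> j > lead_idx e \<and> odd (expo_at e j).
                  xpow (e - unit_expo (lead_idx e) + unit_expo j)))
     \<and> (\<forall>t g. 1 \<le> t \<and> 2 ^ t \<le> d \<and> g \<in> expos k (d - 2 ^ t) \<longrightarrow>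
          pmap k (Sq k (2 ^ t) (xpow g)) = hmap (Sq k (2 ^ t + 1) (xpow g)))
     \<and> rank_hit_mat k d = rho k (d - 1) + rank_red_mat k d"
proof (intro conjI ballI allI impI)
  show "linear2 (pmap k)" by (rule linear_pmap)
  show "pmap k ` homog k d \<subseteq> homog k d" using pmap_homog by blast
  show "pmap k (pmap k f) = pmap k f" if "f \<in> homog k d" for f
    using that by (rule pmap_idem)
  show "pmap k ` homog k d = Tspan k d" using assms(2) by (rule image_pmap)
  show "{f \<in> homog k d. pmap k f = 0} = Sq k 1 ` homog k (d - 1)"
    using assms(2) by (rule kernel_pmap)
  show "mp.dim (Tspan k d) = rho k d" using assms(2) by (rule dim_Tspan)
  show "pmap k (xpow e) =
          (if odd (expo_at e (lead_idx e)) then xpow e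
           else \<Sum>j | j \<in> {1..k} \<and> j > lead_idx e \<and> odd (expo_at e j).
                  xpow (e - unit_expo (lead_idx e) + unit_expo j))" if "e \<in> expos k d" for e
    using that assms(2) by (rule pmap_xpow)
  show "pmap k (Sq k (2 ^ t) (xpow g)) = hmap (Sq k (2 ^ t + 1) (xpow g))"
    if "1 \<le> t \<and> 2 ^ t \<le> d \<and> g \<in> expos k (d - 2 ^ t)" for t g
    using that by (intro pmap_Sq_even) simp
  show "rank_hit_mat k d = rho k (d - 1) + rank_red_mat k d"
    using assms(2) by (rule rank_hit_mat_split)
qed

end
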